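(* Let $Y_1,\dots,Y_n$ be independent random variables supported in $[0,1]$ with identical mean $\mu$, and let $\alpha\in(0,1)$. Let $(\lambda_i)$ be a betting strategy, and let $M_t=\prod_{i=1}^t(1+\lambda_i(Y_i-0.5))$, $M_0=1$, be the wealth process along the original ordering. Let $\pi_1,\dots,\pi_B$ be permutations of $\{1,\dots,n\}$ sampled uniformly at random (with or without replacement), independently of the data, and let $$M_n^b=\prod_{i=1}^n\big(1+\lambda_i(Y_{\pi_b(i)}-0.5)\big),\qquad b=1,\dots,B,$$ where in $M_n^b$ the bets $\lambda_i$ are computed by the same strategy along the ordering $\pi_b$. Let $U$ be uniform on $[0,1]$, independent of the data and the permutations. Then for testing $H_0:\mu=1/2$, the test which (a) rejects if $\sup_{0\le t\le n}M_t\ge1/\alpha$ or $M_n\ge U/\alpha$ controls the type-I error at level $\alpha$, and is more powerful than the rule that rejects if $\sup_{0\le t\le n}M_t\ge1/\alpha$. Likewise, the tests which (b) reject if $\frac{M_n^1+\dots+M_n^B}{B}\ge U/\alpha$; (c) reject if $\sup_{1\le b\le B}\frac{M_n^1+\dots+M_n^b}{b}\ge1/\alpha$; (d) reject if $M_n^1\ge U/\alpha$ or $\sup_{1\le b\le B}\frac{M_n^1+\dots+M_n^b}{b}\ge1/\alpha$ control the type-I error at level $\alpha$ and are more powerful than the rule that rejects if $\frac{M_n^1+\dots+M_n^B}{B}\ge1/\alpha$.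
   Context: A betting strategy assigns to each $i$ a bet $\lambda_i\in[0,2]$ that is a measurable function of the previously observed values: of $Y_1,\dots,Y_{i-1}$ for $M_t$, and of $Y_{\pi_b(1)},\dots,Y_{\pi_b(i-1)}$ for $M_n^b$. When sampling without replacement, $B\le n!$. Controlling the type-I error at level $\alpha$ means that the rejection probability is at most $\alpha$ whenever $\mu=1/2$. "More powerful" is meant in the weak (never worse) sense: the test rejects whenever the compared rule rejects. *)

theory Defs
  imports "HOL-Probability.Probability" "HOL-Combinatorics.Permutations"
begin

text \<open>
  A betting strategy is a sequence of maps \<open>lam i\<close>; the bet \<open>lam i\<close> takes the vector of the first
  \<open>i - 1\<close> observed values, encoded as an extensional function on \<open>{1..<i}\<close>.
\<close>

definition betting_strategy :: "nat \<Rightarrow> (nat \<Rightarrow> (nat \<Rightarrow> real) \<Rightarrow> real) \<Rightarrow> bool" where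
  "betting_strategy n lam \<longleftrightarrow>
     (\<forall>i\<in>{1..n}. lam i \<in> PiM {1..<i} (\<lambda>_. borel) \<rightarrow>\<^sub>M restrict_space borel {0..2})"

text \<open>Here \<open>y i\<close> is the value observed at step \<open>i\<close>, so reordered data give the wealth along
  the reordering.\<close>

definition wealth :: "(nat \<Rightarrow> (nat \<Rightarrow> real) \<Rightarrow> real) \<Rightarrow> nat \<Rightarrow> (nat \<Rightarrow> real) \<Rightarrow> real" where
  "wealth lam t y = (\<Prod>i=1..t. 1 + lam i (restrict y {1..<i}) * (y i - 1/2))"

definition perms :: "nat \<Rightarrow> (nat \<Rightarrow> nat) set" where
  "perms n = {p. p permutes {1..n}}"

definition sampled_with_replacement ::
  "'a measure \<Rightarrow> nat \<Rightarrow> nat \<Rightarrow> (nat \<Rightarrow> 'a \<Rightarrow> nat \<Rightarrow> nat) \<Rightarrow> bool" where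
  "sampled_with_replacement M n B \<pi> \<longleftrightarrow>
     prob_space.indep_vars M (\<lambda>_. count_space (perms n)) \<pi> {1..B} \<and>
     (\<forall>b\<in>{1..B}. distr M (count_space (perms n)) (\<pi> b) = uniform_count_measure (perms n))"

definition distinct_perm_tuples :: "nat \<Rightarrow> nat \<Rightarrow> (nat \<Rightarrow> nat \<Rightarrow> nat) set" where
  "distinct_perm_tuples n B = {s \<in> {1..B} \<rightarrow>\<^sub>E perms n. inj_on s {1..B}}"

definition sampled_without_replacement ::
  "'a measure \<Rightarrow> nat \<Rightarrow> nat \<Rightarrow> (nat \<Rightarrow> 'a \<Rightarrow> nat \<Rightarrow> nat) \<Rightarrow> bool" where
  "sampled_without_replacement M n B \<pi> \<longleftrightarrow>
     B \<le> fact n \<and>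
     (\<lambda>\<omega>. \<lambda>b\<in>{1..B}. \<pi> b \<omega>) \<in> M \<rightarrow>\<^sub>M count_space (distinct_perm_tuples n B) \<and>
     distr M (count_space (distinct_perm_tuples n B)) (\<lambda>\<omega>. \<lambda>b\<in>{1..B}. \<pi> b \<omega>)
       = uniform_count_measure (distinct_perm_tuples n B)"

text \<open>The library's \<open>indep_var\<close> forces both random variables to have the same value type; this is
  the same notion (independence of the generated sigma-algebras) for two different value types.\<close>

definition indep_rvs ::
  "'a measure \<Rightarrow> 'b measure \<Rightarrow> ('a \<Rightarrow> 'b) \<Rightarrow> 'c measure \<Rightarrow> ('a \<Rightarrow> 'c) \<Rightarrow> bool" where
  "indep_rvs M N X L Z \<longleftrightarrow>
     X \<in> M \<rightarrow>\<^sub>M N \<and> Z \<in> M \<rightarrow>\<^sub>M L \<and>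
     prob_space.indep_set M {X -` A \<inter> space M | A. A \<in> sets N} {Z -` A \<inter> space M | A. A \<in> sets L}"

text \<open>Measurability is demanded explicitly, since \<open>measure\<close> is \<open>0\<close> on non-measurable sets.\<close>

definition rejection_prob_le :: "'a measure \<Rightarrow> real \<Rightarrow> ('a \<Rightarrow> bool) \<Rightarrow> bool" where
  "rejection_prob_le M \<alpha> R \<longleftrightarrow>
     {\<omega> \<in> space M. R \<omega>} \<in> sets M \<and> measure M {\<omega> \<in> space M. R \<omega>} \<le> \<alpha>"

end

theory Submission imports Defs begin

text \<open>
  If \<open>E[max(Z, 0)] \<le> 1\<close> and \<open>U\<close> is uniform and independent of \<open>Z\<close>, then \<open>P(Z \<ge> U / \<alpha>) \<le> \<alpha>\<close>: this
  is Markov's inequality after conditioning on \<open>Z\<close>. Each test rejects only if such an event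
  happens for a suitable \<open>Z\<close>. For (a), \<open>Z\<close> is the final wealth of the strategy that stops
  betting once its wealth has reached \<open>1 / \<alpha>\<close>; it has mean one like that of any other strategy.
  For (b), \<open>Z\<close> is the average of the reordered wealths. For (c) and (d), \<open>Z\<close> equals \<open>1 / \<alpha>\<close> if some
  running average reaches \<open>1 / \<alpha>\<close>, and \<open>M_n^1\<close> otherwise. Here \<open>E[Z] \<le> 1\<close> is the maximal
  inequality \<open>c P(S) \<le> E[M_n^1; S]\<close> for exchangeable variables, where \<open>S\<close> is the event that some
  running average reaches \<open>c\<close>. It follows by splitting \<open>S\<close> according to the last crossing time;
  conditionally on the data it is a statement about sums over a finite set of tuples of permutations
  that is closed under transpositions.
\<close>

subsection \<open>Wealth processes\<close>

text \<open>Step \<open>i\<close> consults only coordinates up to \<open>i\<close>. Hence data may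
  be replaced by their restriction to \<open>{1..n}\<close>, or altered at a later coordinate,
  without changing the wealth.\<close>

lemma wealth_cong:
  assumes "\<And>i. i \<in> {1..t} \<Longrightarrow> y i = z i"
  shows "wealth lam t y = wealth lam t z"
  unfolding wealth_def
proof (intro prod.cong refl)
  fix i assume i: "i \<in> {1..t}"
  have "restrict y {1..<i} = restrict z {1..<i}"
    using i assms by (intro restrict_ext) auto
  with assms[OF i] show "1 + lam i (restrict y {1..<i}) * (y i - 1/2) =
      1 + lam i (restrict z {1..<i}) * (z i - 1/2)" by simp
qed

lemma wealth_0 [simp]: "wealth lam 0 y = 1"
  by (simp add: wealth_def)

lemma wealth_Suc:
  "wealth lam (Suc t) y =
     wealth lam t y * (1 + lam (Suc t) (restrict y {1..t}) * (y (Suc t) - 1/2))"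
  by (simp add: wealth_def atLeastLessThanSuc_atLeastAtMost)

lemma betting_strategy_measurable:
  assumes "betting_strategy n lam" "i \<in> {1..n}"
  shows "lam i \<in> borel_measurable (PiM {1..<i} (\<lambda>_. borel))"
proof -
  have "lam i \<in> PiM {1..<i} (\<lambda>_. borel) \<rightarrow>\<^sub>M restrict_space borel {0..2}"
    using assms by (auto simp: betting_strategy_def)
  then show ?thesis by (simp add: measurable_restrict_space2_iff)
qed

lemma betting_strategy_range:
  assumes "betting_strategy n lam" "i \<in> {1..n}"
  shows "lam i (restrict y {1..<i}) \<in> {0..2}"
proof -
  have "lam i \<in> PiM {1..<i} (\<lambda>_. borel) \<rightarrow>\<^sub>M restrict_space borel {0..2}"
    using assms by (auto simp: betting_strategy_def)
  then show ?thesis by (auto simp: measurable_restrict_space2_iff space_PiM)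
qed

lemma wealth_measurable:
  assumes strat: "betting_strategy n lam" and t: "t \<le> n"
    and Z: "\<And>i. i \<in> {1..t} \<Longrightarrow> Z i \<in> borel_measurable N"
  shows "(\<lambda>x. wealth lam t (\<lambda>i. Z i x)) \<in> borel_measurable N"
proof -
  have "(\<lambda>x. lam i (\<lambda>k\<in>{1..<i}. Z k x)) \<in> borel_measurable N" if "i \<in> {1..t}" for i
    by (rule measurable_compose[OF measurable_restrict betting_strategy_measurable[OF strat]])
       (use that t Z in auto)
  then show ?thesis
    unfolding wealth_def
    by (intro borel_measurable_prod borel_measurable_add borel_measurable_times
        borel_measurable_diff borel_measurable_const Z) auto
qed

text \<open>Induction on \<open>t\<close>, integrating out the last coordinate first. With the
  earlier values fixed, the next bet is a constant \<open>l\<close>, and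
  \<open>1 + l * (y - 1/2)\<close> integrates to one because \<open>y\<close> has mean one
  half.\<close>

lemma nn_integral_wealth_PiM:
  fixes N :: "nat \<Rightarrow> real measure"
  assumes prob: "\<And>i. prob_space (N i)" and sets: "\<And>i. sets (N i) = sets borel"
    and supp: "\<And>i. i \<in> {1..n} \<Longrightarrow> AE x in N i. x \<in> {0..1}"
    and mean: "\<And>i. i \<in> {1..n} \<Longrightarrow> (\<integral>x. x \<partial>N i) = 1/2"
    and strat: "betting_strategy n lam"
  shows "t \<le> n \<Longrightarrow> (\<integral>\<^sup>+y. ennreal (wealth lam t y) \<partial>PiM {1..t} N) = 1"
proof (induction t)
  case 0
  interpret prob_space "PiM {1..0} N" by (intro prob_space_PiM prob)
  show ?case using emeasure_space_1 by simp
next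
  case (Suc t)
  interpret P: product_sigma_finite N
    by (intro product_sigma_finite.intro prob_space_imp_sigma_finite prob)
  interpret N: prob_space "N (Suc t)" by (rule prob)
  have S: "Suc t \<in> {1..n}" using Suc.prems by auto
  have comp: "(\<lambda>y. y i) \<in> borel_measurable (PiM I N)" if "i \<in> I" for i I
    using measurable_component_singleton[OF that, of N] by (simp add: measurable_cong_sets[OF refl sets])
  have "(\<integral>\<^sup>+y. ennreal (wealth lam (Suc t) y) \<partial>PiM {1..Suc t} N) =
      (\<integral>\<^sup>+y. ennreal (wealth lam (Suc t) y) \<partial>PiM (insert (Suc t) {1..t}) N)"
    by (simp add: atLeastAtMostSuc_conv)
  also have "\<dots> = (\<integral>\<^sup>+x. \<integral>\<^sup>+y. ennreal (wealth lam (Suc t) (x(Suc t := y))) \<partial>N (Suc t) \<partial>PiM {1..t} N)"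
  proof (rule P.product_nn_integral_insert)
    show "(\<lambda>y. ennreal (wealth lam (Suc t) y)) \<in> borel_measurable (PiM (insert (Suc t) {1..t}) N)"
      by (intro measurable_compose[OF wealth_measurable[OF strat Suc.prems] measurable_ennreal] comp)
        auto
  qed auto
  also have "\<dots> = (\<integral>\<^sup>+x. ennreal (wealth lam t x) \<partial>PiM {1..t} N)"
  proof (rule nn_integral_cong)
    fix x
    define l where "l = lam (Suc t) (restrict x {1..t})"
    have l: "0 \<le> l" "l \<le> 2"
      using betting_strategy_range[OF strat S, of x]
      by (auto simp: l_def atLeastLessThanSuc_atLeastAtMost)
    have eq: "wealth lam (Suc t) (x(Suc t := y)) = wealth lam t x * (1 + l * (y - 1/2))" for y
      using wealth_cong[of t "x(Suc t := y)" x lam]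
        restrict_ext[of "{1..t}" "x(Suc t := y)" x]
      by (simp add: wealth_Suc l_def)
    \<comment> \<open>The extreme case is the bet 2 on the value 0, where the factor is exactly 0.
      This is where the upper limit on bets enters.\<close>
    have nonneg: "AE y in N (Suc t). 0 \<le> 1 + l * (y - 1/2)"
      using supp[OF S]
    proof eventually_elim
      case (elim y)
      have "l * (1/2 - y) \<le> 2 * (1/2)"
        by (rule order_trans[OF mult_left_mono[of _ "1/2"] mult_right_mono]) (use elim l in auto)
      then show ?case by (simp add: algebra_simps)
    qed
    have id: "(\<lambda>y. y) \<in> borel_measurable (N (Suc t))"
      by (simp add: measurable_cong_sets[OF sets refl])
    have int: "integrable (N (Suc t)) (\<lambda>y. y)"
      by (rule N.integrable_const_bound[of _ 1]) (use supp[OF S] id in auto)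
    have "(\<integral>\<^sup>+y. ennreal (wealth lam (Suc t) (x(Suc t := y))) \<partial>N (Suc t)) =
        (\<integral>\<^sup>+y. ennreal (wealth lam t x) * ennreal (1 + l * (y - 1/2)) \<partial>N (Suc t))"
      \<comment> \<open>Only the new factor must be nonnegative for \<open>ennreal\<close> to split:
        if the earlier wealth is negative, both sides are zero.\<close>
      by (rule nn_integral_cong_AE) (use nonneg in \<open>eventually_elim, simp add: eq ennreal_mult''\<close>)
    also have "\<dots> = ennreal (wealth lam t x) * (\<integral>\<^sup>+y. ennreal (1 + l * (y - 1/2)) \<partial>N (Suc t))"
      using id
      by (intro nn_integral_cmult measurable_compose[OF _ measurable_ennreal] borel_measurable_add
          borel_measurable_times borel_measurable_diff borel_measurable_const)
    also have "(\<integral>\<^sup>+y. ennreal (1 + l * (y - 1/2)) \<partial>N (Suc t)) =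
        ennreal (\<integral>y. 1 + l * (y - 1/2) \<partial>N (Suc t))"
      by (rule nn_integral_eq_integral[OF _ nonneg]) (use int in auto)
    also have "(\<integral>y. 1 + l * (y - 1/2) \<partial>N (Suc t)) = 1"
      using int by (simp add: mean[OF S] N.prob_space)
    finally show "(\<integral>\<^sup>+y. ennreal (wealth lam (Suc t) (x(Suc t := y))) \<partial>N (Suc t)) =
        ennreal (wealth lam t x)" by (simp only: ennreal_1 mult_1_right)
  qed
  also have "\<dots> = 1" using Suc by simp
  finally show ?case .
qed

text \<open>Independence turns the joint law of the observations into a product measure, and the
  integral is transported there.\<close>

lemma (in prob_space) nn_integral_wealth_indep:
  assumes indep: "indep_vars (\<lambda>_. borel) Z {1..n}"
    and supp: "\<And>i. i \<in> {1..n} \<Longrightarrow> AE \<omega> in M. Z i \<omega> \<in> {0..1}"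
    and mean: "\<And>i. i \<in> {1..n} \<Longrightarrow> expectation (Z i) = 1/2"
    and strat: "betting_strategy n lam"
  shows "(\<integral>\<^sup>+\<omega>. ennreal (wealth lam n (\<lambda>i. Z i \<omega>)) \<partial>M) = 1"
\<comment> \<open>The characterization of independence by a product law requires a nonempty index
  set.\<close>
proof (cases "n = 0")
  case True
  then show ?thesis by (simp add: emeasure_space_1)
next
  case False
  \<comment> \<open>A probability measure is required at every index, so indices outside
    \<open>{1..n}\<close> receive a point mass at zero.\<close>
  define N where "N i = (if i \<in> {1..n} then distr M borel (Z i) else return borel (0::real))" for i
  have Z: "Z i \<in> borel_measurable M" if "i \<in> {1..n}" for i
    using indep that by (auto simp: indep_vars_def)
  have "distr M (PiM {1..n} (\<lambda>_. borel)) (\<lambda>\<omega>. \<lambda>i\<in>{1..n}. Z i \<omega>) =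
      PiM {1..n} (\<lambda>i. distr M borel (Z i))"
    using False indep Z by (subst indep_vars_iff_distr_eq_PiM'[symmetric]) auto
  also have "\<dots> = PiM {1..n} N"
    by (intro PiM_cong) (auto simp: N_def)
  finally have law: "distr M (PiM {1..n} (\<lambda>_. borel)) (\<lambda>\<omega>. \<lambda>i\<in>{1..n}. Z i \<omega>) = PiM {1..n} N" .
  have "(\<integral>\<^sup>+\<omega>. ennreal (wealth lam n (\<lambda>i. Z i \<omega>)) \<partial>M) =
      (\<integral>\<^sup>+\<omega>. ennreal (wealth lam n (\<lambda>i\<in>{1..n}. Z i \<omega>)) \<partial>M)"
    using wealth_cong[of n] by (intro nn_integral_cong arg_cong[of _ _ ennreal] wealth_cong) auto
  also have "\<dots> = (\<integral>\<^sup>+y. ennreal (wealth lam n y)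
      \<partial>distr M (PiM {1..n} (\<lambda>_. borel)) (\<lambda>\<omega>. \<lambda>i\<in>{1..n}. Z i \<omega>))"
    using wealth_measurable[OF strat order_refl, of "\<lambda>i y. y i" "PiM {1..n} (\<lambda>_. borel)"]
    by (intro nn_integral_distr[symmetric] measurable_restrict Z) auto
  also have "\<dots> = 1"
    unfolding law
  proof (rule nn_integral_wealth_PiM[OF _ _ _ _ strat order_refl])
    show "prob_space (N i)" for i
      by (auto simp: N_def intro!: prob_space_distr prob_space_return Z)
    show "sets (N i) = sets borel" for i
      by (simp add: N_def)
    fix i assume i: "i \<in> {1..n}"
    show "AE x in N i. x \<in> {0..1}"
      using supp[OF i] i by (simp only: N_def if_True) (subst AE_distr_iff[OF Z[OF i]], auto)
    show "(\<integral>x. x \<partial>N i) = 1/2"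
      using mean[OF i] i by (simp add: N_def integral_distr[OF Z[OF i]])
  qed
  finally show ?thesis .
qed

text \<open>A zero bet freezes the wealth, so stopping at level \<open>c\<close> is again a betting
  strategy. The fixed-horizon mean then does the work of optional stopping. Only times
  \<open>t < i\<close> are inspected, and their wealth is determined by the values observed before
  step \<open>i\<close>.\<close>

definition stop_betting ::
  "real \<Rightarrow> (nat \<Rightarrow> (nat \<Rightarrow> real) \<Rightarrow> real) \<Rightarrow> nat \<Rightarrow> (nat \<Rightarrow> real) \<Rightarrow> real" where
  "stop_betting c lam i z = (if \<exists>t<i. c \<le> wealth lam t z then 0 else lam i z)"

lemma betting_strategy_stop_betting:
  assumes strat: "betting_strategy n lam"
  shows "betting_strategy n (stop_betting c lam)"
  unfolding betting_strategy_def
proof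
  fix i assume i: "i \<in> {1..n}"
  let ?P = "PiM {1..<i} (\<lambda>_. borel) :: (nat \<Rightarrow> real) measure"
  have meas: "wealth lam t \<in> borel_measurable ?P" if "t < i" for t
    by (rule wealth_measurable[OF strat, of t "\<lambda>i y. y i"]) (use that i in auto)
  have "{z \<in> space ?P. c \<le> wealth lam t z} \<in> sets ?P" if "t < i" for t
    using borel_measurable_le[OF borel_measurable_const meas[OF that]] by simp
  then have "(\<Union>t\<in>{..<i}. {z \<in> space ?P. c \<le> wealth lam t z}) \<in> sets ?P"
    by (intro sets.finite_UN) auto
  also have "(\<Union>t\<in>{..<i}. {z \<in> space ?P. c \<le> wealth lam t z}) =
      {z \<in> space ?P. \<exists>t<i. c \<le> wealth lam t z}" by auto
  finally have "stop_betting c lam i \<in> borel_measurable ?P"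
    unfolding stop_betting_def
    by (intro measurable_If borel_measurable_const betting_strategy_measurable[OF strat i])
  moreover have "lam i z \<in> {0..2}" if "z \<in> space ?P" for z
    using betting_strategy_range[OF strat i, of z] that
    by (simp only: space_PiM PiE_restrict)
  ultimately show "stop_betting c lam i \<in> ?P \<rightarrow>\<^sub>M restrict_space borel {0..2}"
    by (intro measurable_restrict_space2) (simp_all add: stop_betting_def)
qed

text \<open>Both strategies make the same bets up to and including the step that first reaches
  \<open>c\<close>; afterwards the stopped wealth stays constant.\<close>

lemma wealth_stop_betting:
  "if \<exists>k\<le>t. c \<le> wealth lam k y then c \<le> wealth (stop_betting c lam) t y
   else wealth (stop_betting c lam) t y = wealth lam t y"
proof (induction t)
  case 0
  show ?case by simp
next
  case (Suc t)
  have "wealth lam k (restrict y {Suc 0..t}) = wealth lam k y" if "k < Suc t" for k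
    using that by (intro wealth_cong) auto
  then have hit: "(\<exists>k<Suc t. c \<le> wealth lam k (restrict y {Suc 0..t})) \<longleftrightarrow> (\<exists>k\<le>t. c \<le> wealth lam k y)"
    by (metis less_Suc_eq_le)
  show ?case
  proof (cases "\<exists>k\<le>t. c \<le> wealth lam k y")
    case True
    then have "wealth (stop_betting c lam) (Suc t) y = wealth (stop_betting c lam) t y"
      by (simp only: wealth_Suc stop_betting_def[of c lam "Suc t"] hit One_nat_def if_True) simp
    moreover have "\<exists>k\<le>Suc t. c \<le> wealth lam k y" using True le_SucI by blast
    ultimately show ?thesis using Suc.IH True by (simp only: if_True)
  next
    case False
    \<comment> \<open>The bet at \<open>Suc t\<close> looks only at times up to \<open>t\<close>, so
      this step is still made when it is itself the crossing.\<close>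
    then have eq: "wealth (stop_betting c lam) (Suc t) y = wealth lam (Suc t) y"
      using Suc.IH by (simp only: wealth_Suc stop_betting_def[of c lam "Suc t"] hit One_nat_def if_False)
    show ?thesis
    proof (cases "c \<le> wealth lam (Suc t) y")
      case True
      then have "\<exists>k\<le>Suc t. c \<le> wealth lam k y" by blast
      then show ?thesis using True eq by (simp only: if_True)
    next
      case nhit: False
      then have "\<not> (\<exists>k\<le>Suc t. c \<le> wealth lam k y)"
        using False by (metis le_SucE)
      then show ?thesis using eq by (simp only: if_False)
    qed
  qed
qed

subsection \<open>Exchangeable tuples\<close>

text \<open>Composition with the transposition is an involution of \<open>A\<close> that exchanges
  coordinates \<open>i\<close> and \<open>j\<close>. This is exchangeability in counting
  form.\<close>

lemma sum_swap_reindex: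
  fixes f :: "'b \<Rightarrow> 'c::comm_monoid_add"
  assumes "\<And>s. s \<in> A \<Longrightarrow> s \<circ> Transposition.transpose i j \<in> A"
  shows "(\<Sum>s\<in>A. f (s i)) = (\<Sum>s\<in>A. f (s j))"
proof (rule sum.reindex_bij_witness[where i="\<lambda>s. s \<circ> Transposition.transpose i j"
      and j="\<lambda>s. s \<circ> Transposition.transpose i j"])
  show "s \<circ> Transposition.transpose i j \<circ> Transposition.transpose i j = s" for s :: "'a \<Rightarrow> 'b"
    by (simp add: comp_assoc)
qed (use assms in auto)

lemma average_swap:
  fixes g :: "'b \<Rightarrow> real" and j k :: nat
  assumes "j \<in> {1..k}"
  shows "(\<Sum>i=1..k. g ((s \<circ> Transposition.transpose 1 j) i)) = (\<Sum>i=1..k. g (s i))"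
proof -
  have "Transposition.transpose 1 j permutes {1..k}"
    using assms by (intro permutes_swap_id) auto
  from sum.permute[OF this, of "\<lambda>i. g (s i)"] show ?thesis by (simp add: o_def)
qed

text \<open>A counting form of Doob's maximal inequality for the running averages read backwards in
  \<open>b\<close>, in which direction they form a martingale. This explains the decomposition by
  the last crossing: a first crossing would constrain the averages before \<open>b\<close>, which a
  swap can change.\<close>

lemma exchangeable_maximal_inequality:
  fixes g :: "'b \<Rightarrow> real" and T :: "(nat \<Rightarrow> 'b) set" and c :: real
  assumes fin: "finite T"
    and swap: "\<And>s j. s \<in> T \<Longrightarrow> j \<in> {1..B} \<Longrightarrow> s \<circ> Transposition.transpose 1 j \<in> T"
  defines "S \<equiv> {s \<in> T. \<exists>b\<in>{1..B}. c \<le> (\<Sum>j=1..b. g (s j)) / real b}"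
  shows "c * real (card S) \<le> (\<Sum>s\<in>S. g (s 1))"
proof -
  define avg where "avg b s = (\<Sum>j=1..b. g (s j)) / real b" for b s
  define L where "L b = {s \<in> T. c \<le> avg b s \<and> (\<forall>b'\<in>{b<..B}. avg b' s < c)}" for b
  \<comment> \<open>\<open>L b\<close>: the running average crosses \<open>c\<close> for the last time at \<open>b\<close>. This only depends on the
    first \<open>b\<close> values through their sum, so it survives swapping \<open>1\<close> with any \<open>j \<le> b\<close>.\<close>
  have S: "S = (\<Union>b\<in>{1..B}. L b)"
  proof (intro equalityI subsetI)
    fix s assume "s \<in> S"
    then have s: "s \<in> T" and ne: "{b \<in> {1..B}. c \<le> avg b s} \<noteq> {}" (is "?H \<noteq> {}")
      by (auto simp: S_def avg_def)
    have "Max ?H \<in> ?H" by (rule Max_in[OF _ ne]) simp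
    moreover have "avg b' s < c" if b': "b' \<in> {Max ?H<..B}" for b'
    proof (rule ccontr)
      assume "\<not> avg b' s < c"
      then have "b' \<in> ?H" using b' by auto
      then have "b' \<le> Max ?H" by (intro Max_ge) auto
      with b' show False by simp
    qed
    ultimately have "s \<in> L (Max ?H)" "Max ?H \<in> {1..B}" using s by (auto simp: L_def)
    then show "s \<in> (\<Union>b\<in>{1..B}. L b)" by blast
  next
    fix s assume "s \<in> (\<Union>b\<in>{1..B}. L b)"
    then show "s \<in> S" by (auto simp: S_def L_def avg_def)
  qed
  have finL: "finite (L b)" for b using fin by (simp add: L_def)
  have less: "L b \<inter> L b' = {}" if "b < b'" "b' \<le> B" for b b'
  proof -
    have "avg b' s < c" if "s \<in> L b" for s
      using that \<open>b < b'\<close> \<open>b' \<le> B\<close> unfolding L_def by simp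
    moreover have "c \<le> avg b' s" if "s \<in> L b'" for s
      using that unfolding L_def by simp
    ultimately show ?thesis by (meson disjoint_iff not_less)
  qed
  have disj: "L b \<inter> L b' = {}" if "b \<in> {1..B}" "b' \<in> {1..B}" "b \<noteq> b'" for b b'
    using less[of b b'] less[of b' b] that by (metis Int_commute atLeastAtMost_iff nat_neq_iff)
  have split: "(\<Sum>s\<in>S. h s) = (\<Sum>b=1..B. \<Sum>s\<in>L b. h s)" for h :: "(nat \<Rightarrow> 'b) \<Rightarrow> real"
    unfolding S by (rule sum.UNION_disjoint) (use finL disj in blast)+
  have "c * real (card (L b)) \<le> (\<Sum>s\<in>L b. g (s 1))" if b: "b \<in> {1..B}" for b
  proof -
    have closed: "s \<circ> Transposition.transpose 1 j \<in> L b" if "s \<in> L b" "j \<in> {1..b}" for s j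
    proof -
      have "avg k (s \<circ> Transposition.transpose 1 j) = avg k s" if "b \<le> k" for k
        using average_swap[of j k g s] \<open>j \<in> {1..b}\<close> that by (simp add: avg_def)
      then show ?thesis using that swap[of s j] b by (auto simp: L_def)
    qed
    have "c * real (card (L b)) = (\<Sum>s\<in>L b. c)" by simp
    also have "\<dots> \<le> (\<Sum>s\<in>L b. avg b s)" by (intro sum_mono) (simp add: L_def)
    also have "\<dots> = (\<Sum>j=1..b. \<Sum>s\<in>L b. g (s j)) / real b"
      unfolding avg_def sum_divide_distrib[symmetric] by (subst sum.swap) simp
    \<comment> \<open>By the closure of \<open>L b\<close> under swaps, each of the first
      \<open>b\<close> coordinates has the same total as coordinate 1.\<close>
    also have "\<dots> = (\<Sum>j=1..b. \<Sum>s\<in>L b. g (s 1)) / real b"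
      using sum_swap_reindex[OF closed, where f=g] by simp
    also have "\<dots> = (\<Sum>s\<in>L b. g (s 1))" using b by simp
    finally show ?thesis .
  qed
  then have "(\<Sum>b=1..B. c * real (card (L b))) \<le> (\<Sum>b=1..B. \<Sum>s\<in>L b. g (s 1))"
    by (intro sum_mono)
  then show ?thesis
    using split[of "\<lambda>_. c"] split[of "\<lambda>s. g (s 1)"] by (simp add: mult.commute)
qed

text \<open>Negative terms are truncated one by one on the right but may cancel on the left. Signs
  matter because the data lie in the unit interval only almost surely, so a wealth can be negative
  on a null event.\<close>

lemma ennreal_sum_le: "ennreal (\<Sum>i\<in>A. f i) \<le> (\<Sum>i\<in>A. ennreal (f i))"
proof -
  have "ennreal (\<Sum>i\<in>A. f i) \<le> ennreal (\<Sum>i\<in>A. max 0 (f i))"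
    by (intro ennreal_leI sum_mono) simp
  also have "\<dots> = (\<Sum>i\<in>A. ennreal (max 0 (f i)))"
    by (rule sum_ennreal[symmetric]) simp
  also have "\<dots> = (\<Sum>i\<in>A. ennreal (f i))"
    by (intro sum.cong refl) (simp add: max_def ennreal_neg)
  finally show ?thesis .
qed

text \<open>On the tuples whose running average reaches \<open>c\<close>, the maximal inequality
  exchanges \<open>c\<close> for \<open>g (s 1)\<close>; on the others the summands
  coincide.\<close>

lemma exchangeable_stopped_sum_le:
  fixes g :: "'b \<Rightarrow> real" and T :: "(nat \<Rightarrow> 'b) set" and c :: real
  assumes fin: "finite T"
    and swap: "\<And>s j. s \<in> T \<Longrightarrow> j \<in> {1..B} \<Longrightarrow> s \<circ> Transposition.transpose 1 j \<in> T"
    and c: "0 \<le> c"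
  shows "(\<Sum>s\<in>T. ennreal (if \<exists>b\<in>{1..B}. c \<le> (\<Sum>j=1..b. g (s j)) / real b then c else g (s 1)))
    \<le> (\<Sum>s\<in>T. ennreal (g (s 1)))"
proof -
  define S where "S = {s \<in> T. \<exists>b\<in>{1..B}. c \<le> (\<Sum>j=1..b. g (s j)) / real b}"
  have ST: "T = S \<union> (T - S)" "finite S" "finite (T - S)" "S \<inter> (T - S) = {}"
    using fin by (auto simp: S_def)
  have "(\<Sum>s\<in>S. ennreal c) = ennreal (c * real (card S))"
    using c by (simp add: ennreal_mult ennreal_of_nat_eq_real_of_nat mult.commute)
  also have "\<dots> \<le> ennreal (\<Sum>s\<in>S. g (s 1))"
    unfolding S_def by (intro ennreal_leI exchangeable_maximal_inequality fin swap)
  also have "\<dots> \<le> (\<Sum>s\<in>S. ennreal (g (s 1)))" by (rule ennreal_sum_le)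
  finally have hit: "(\<Sum>s\<in>S. ennreal c) \<le> (\<Sum>s\<in>S. ennreal (g (s 1)))" .
  let ?f = "\<lambda>s. ennreal (if \<exists>b\<in>{1..B}. c \<le> (\<Sum>j=1..b. g (s j)) / real b then c else g (s 1))"
  have "sum ?f T = sum ?f S + sum ?f (T - S)"
    by (subst ST(1), rule sum.union_disjoint) (use ST in auto)
  also have "sum ?f S = (\<Sum>s\<in>S. ennreal c)"
    by (intro sum.cong refl) (simp add: S_def)
  also have "sum ?f (T - S) = (\<Sum>s\<in>T - S. ennreal (g (s 1)))"
    by (intro sum.cong refl) (auto simp: S_def)
  also have "(\<Sum>s\<in>S. ennreal c) + (\<Sum>s\<in>T - S. ennreal (g (s 1))) \<le>
      (\<Sum>s\<in>S. ennreal (g (s 1))) + (\<Sum>s\<in>T - S. ennreal (g (s 1)))"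
    by (intro add_right_mono hit)
  also have "\<dots> = (\<Sum>s\<in>S \<union> (T - S). ennreal (g (s 1)))"
    by (rule sum.union_disjoint[symmetric]) (use ST in auto)
  also have "\<dots> = (\<Sum>s\<in>T. ennreal (g (s 1)))" using ST(1) by simp
  finally show ?thesis .
qed

subsection \<open>Independence and the randomized Markov inequality\<close>

text \<open>A choice of events over a finite \<open>J\<close> is carried along the injection to its
  image, where the product formula is available. It serves to reorder the data by a fixed
  permutation.\<close>

lemma (in prob_space) indep_vars_reindex:
  assumes indep: "indep_vars M' X (f ` I)" and inj: "inj_on f I"
  shows "indep_vars (\<lambda>i. M' (f i)) (\<lambda>i. X (f i)) I"
proof -
  let ?F = "\<lambda>i. {X i -` A \<inter> space M | A. A \<in> sets (M' i)}"
  have rv: "\<forall>i\<in>f ` I. random_variable (M' i) (X i)" and F: "indep_sets ?F (f ` I)"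
    using indep by (auto simp: indep_vars_def2)
  have "indep_sets (\<lambda>i. ?F (f i)) I"
    unfolding indep_sets_def
  proof (intro conjI allI impI ballI)
    show "?F (f i) \<subseteq> events" if "i \<in> I" for i
      using rv that by (auto intro: measurable_sets)
    fix J A assume J: "J \<subseteq> I" "J \<noteq> {}" "finite J" and A: "A \<in> Pi J (\<lambda>i. ?F (f i))"
    have injJ: "inj_on f J" using inj J(1) by (rule inj_on_subset)
    define A' where "A' k = A (the_inv_into J f k)" for k
    have A': "A' (f j) = A j" if "j \<in> J" for j
      using the_inv_into_f_f[OF injJ that] by (simp add: A'_def)
    have "\<forall>k\<in>f ` J. A' k \<in> ?F k"
    proof
      fix k assume "k \<in> f ` J"
      then obtain j where "j \<in> J" "k = f j" by blast
      then show "A' k \<in> ?F k" using A'[of j] A Pi_mem[OF A, of j] by simp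
    qed
    then have "prob (\<Inter>k\<in>f ` J. A' k) = (\<Prod>k\<in>f ` J. prob (A' k))"
      using J by (intro indep_setsD[OF F]) auto
    then show "prob (\<Inter>j\<in>J. A j) = (\<Prod>j\<in>J. prob (A j))"
      using A' by (simp add: prod.reindex[OF injJ] cong: INF_cong)
  qed
  then show ?thesis using rv by (auto simp: indep_vars_def2)
qed

text \<open>The two measures agree on measurable rectangles, which determine them. The product form
  is what allows conditioning by Fubini's theorem.\<close>

lemma (in prob_space) indep_rvs_distr_pair:
  assumes "indep_rvs M N X L Z"
  shows "distr M (N \<Otimes>\<^sub>M L) (\<lambda>\<omega>. (X \<omega>, Z \<omega>)) = distr M N X \<Otimes>\<^sub>M distr M L Z"
proof (rule pair_measure_eqI[symmetric])
  have X[measurable]: "X \<in> M \<rightarrow>\<^sub>M N" and Z[measurable]: "Z \<in> M \<rightarrow>\<^sub>M L"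
    and ind: "indep_set {X -` A \<inter> space M | A. A \<in> sets N} {Z -` A \<inter> space M | A. A \<in> sets L}"
    using assms by (auto simp: indep_rvs_def)
  show "sigma_finite_measure (distr M N X)" "sigma_finite_measure (distr M L Z)"
    by (intro prob_space_imp_sigma_finite prob_space_distr X Z)+
  show "sets (distr M N X \<Otimes>\<^sub>M distr M L Z) = sets (distr M (N \<Otimes>\<^sub>M L) (\<lambda>\<omega>. (X \<omega>, Z \<omega>)))"
    by (simp cong: sets_pair_measure_cong)
  fix A C assume "A \<in> sets (distr M N X)" "C \<in> sets (distr M L Z)"
  then have A: "A \<in> sets N" and C: "C \<in> sets L" by auto
  have "(\<lambda>\<omega>. (X \<omega>, Z \<omega>)) -` (A \<times> C) \<inter> space M = (X -` A \<inter> space M) \<inter> (Z -` C \<inter> space M)"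
    by auto
  moreover have "prob ((X -` A \<inter> space M) \<inter> (Z -` C \<inter> space M)) =
      prob (X -` A \<inter> space M) * prob (Z -` C \<inter> space M)"
    by (rule indep_setD[OF ind]) (use A C in blast)+
  ultimately show "emeasure (distr M N X) A * emeasure (distr M L Z) C =
      emeasure (distr M (N \<Otimes>\<^sub>M L) (\<lambda>\<omega>. (X \<omega>, Z \<omega>))) (A \<times> C)"
    using A C X Z measurable_Pair[OF X Z]
    by (simp add: emeasure_distr emeasure_eq_measure ennreal_mult)
qed

text \<open>Equality holds up to \<open>c = 1\<close>, with both sides zero for negative
  \<open>c\<close>; beyond 1 the probability saturates.\<close>

lemma emeasure_uniform_atMost_le:
  "emeasure (uniform_measure lborel {0..1}) {..c} \<le> ennreal (c::real)"
proof (cases "0 \<le> c")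
  case True
  have "{0..1} \<inter> {..c} = {0..min 1 c}" by auto
  then have "emeasure (uniform_measure lborel {0..1}) {..c} =
      emeasure lborel {0..min 1 c} / emeasure lborel {0..1::real}"
    by (subst emeasure_uniform_measure) auto
  also have "\<dots> = ennreal (min 1 c)"
    using True by (simp add: divide_ennreal[of _ 1, simplified])
  also have "\<dots> \<le> ennreal c" by (rule ennreal_leI) simp
  finally show ?thesis .
next
  case False
  then have "{0..1} \<inter> {..c} = {}" by auto
  then show ?thesis by simp
qed

text \<open>By Fubini, with \<open>X\<close> fixed at \<open>x\<close> the event has probability at
  most the positive part of \<open>a * H x\<close>; integrating over the law of \<open>X\<close>
  gives the bound.\<close>

lemma (in prob_space) uniform_randomized_markov:
  fixes H :: "'b \<Rightarrow> real"
  assumes indep: "indep_rvs M N X borel U"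
    and U: "distr M borel U = uniform_measure lborel {0..1}"
    and H: "H \<in> borel_measurable N"
    and E: "(\<integral>\<^sup>+\<omega>. ennreal (H (X \<omega>)) \<partial>M) \<le> 1"
    and a: "0 \<le> a"
  shows "prob {\<omega> \<in> space M. U \<omega> \<le> a * H (X \<omega>)} \<le> a"
proof -
  note [measurable] = H
  have X[measurable]: "X \<in> M \<rightarrow>\<^sub>M N" and U_meas[measurable]: "U \<in> borel_measurable M"
    using indep by (auto simp: indep_rvs_def)
  interpret U: prob_space "distr M borel U" by (rule prob_space_distr) simp
  let ?E = "{p \<in> space (N \<Otimes>\<^sub>M (borel :: real measure)). snd p \<le> a * H (fst p)}"
  have E_sets: "?E \<in> sets (N \<Otimes>\<^sub>M borel)" by measurable
  have "ennreal (prob {\<omega> \<in> space M. U \<omega> \<le> a * H (X \<omega>)}) =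
      emeasure (distr M (N \<Otimes>\<^sub>M borel) (\<lambda>\<omega>. (X \<omega>, U \<omega>))) ?E"
    using E_sets measurable_space[OF X]
    by (subst emeasure_distr)
      (auto simp: emeasure_eq_measure space_pair_measure intro!: arg_cong[of _ _ prob])
  also have "\<dots> = (\<integral>\<^sup>+x. emeasure (distr M borel U) (Pair x -` ?E) \<partial>distr M N X)"
    unfolding indep_rvs_distr_pair[OF indep]
    by (rule U.emeasure_pair_measure_alt) (use E_sets in \<open>simp cong: sets_pair_measure_cong\<close>)
  also have "\<dots> = (\<integral>\<^sup>+x. emeasure (distr M borel U) {..a * H x} \<partial>distr M N X)"
    by (intro nn_integral_cong arg_cong[of _ _ "emeasure _"]) (auto simp: space_pair_measure)
  also have "\<dots> \<le> (\<integral>\<^sup>+x. ennreal (a * H x) \<partial>distr M N X)"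
    unfolding U by (intro nn_integral_mono emeasure_uniform_atMost_le)
  also have "\<dots> = (\<integral>\<^sup>+\<omega>. ennreal a * ennreal (H (X \<omega>)) \<partial>M)"
    using a by (subst nn_integral_distr) (auto simp: ennreal_mult')
  also have "\<dots> = ennreal a * (\<integral>\<^sup>+\<omega>. ennreal (H (X \<omega>)) \<partial>M)"
    by (rule nn_integral_cmult) measurable
  also have "\<dots> \<le> ennreal a * 1" by (intro mult_left_mono E) auto
  finally show ?thesis using a by simp
qed

subsection \<open>Uniformly sampled permutations\<close>

lemma finite_perms: "finite (perms n)"
  by (simp add: perms_def finite_permutations)

lemma perms_nonempty: "perms n \<noteq> {}"
  using permutes_id[of "{1..n}"] unfolding perms_def by blast

lemma PiM_perms: "PiM {1..B} (\<lambda>_. count_space (perms n)) = count_space ({1..B} \<rightarrow>\<^sub>E perms n)"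
  for B :: nat
  by (rule count_space_PiM_finite) (simp_all add: countable_finite finite_perms)

lemma nn_integral_uniform_count_measure:
  "finite A \<Longrightarrow> (\<integral>\<^sup>+x. f x \<partial>uniform_count_measure A) = (\<Sum>x\<in>A. f x) * ennreal (1 / card A)"
  by (simp add: uniform_count_measure_def nn_integral_point_measure_finite
      sum_distrib_right mult.commute)

text \<open>Both measures live on a finite set, so singletons decide. With it, sampling with
  replacement becomes a uniform draw from a set of tuples, like sampling without
  replacement.\<close>

lemma PiM_uniform_count_measure:
  fixes A :: "'b set"
  assumes A: "finite A" "A \<noteq> {}" and I: "finite I"
  shows "PiM I (\<lambda>_. uniform_count_measure A) = uniform_count_measure (I \<rightarrow>\<^sub>E A)"
proof (rule measure_eqI_finite)
  interpret product_sigma_finite "\<lambda>_. uniform_count_measure A"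
    by (intro product_sigma_finite.intro prob_space_imp_sigma_finite prob_space_uniform_count_measure A)
  have fin: "finite (I \<rightarrow>\<^sub>E A)" using A I by (simp add: finite_PiE)
  have "sets (PiM I (\<lambda>_. uniform_count_measure A)) = sets (PiM I (\<lambda>_. count_space A))"
    by (intro sets_PiM_cong) (auto simp: sets_uniform_count_measure)
  also have "\<dots> = Pow (I \<rightarrow>\<^sub>E A)"
    using A I by (subst count_space_PiM_finite) (auto simp: countable_finite)
  finally show "sets (PiM I (\<lambda>_. uniform_count_measure A)) = Pow (I \<rightarrow>\<^sub>E A)" .
  show "sets (uniform_count_measure (I \<rightarrow>\<^sub>E A)) = Pow (I \<rightarrow>\<^sub>E A)"
    by (simp add: sets_uniform_count_measure)
  show "finite (I \<rightarrow>\<^sub>E A)" by fact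
  fix s assume s: "s \<in> I \<rightarrow>\<^sub>E A"
  have "emeasure (PiM I (\<lambda>_. uniform_count_measure A)) {s} =
      emeasure (PiM I (\<lambda>_. uniform_count_measure A)) (PiE I (\<lambda>i. {s i}))"
    using PiE_singleton[of s I] s by (simp add: PiE_def)
  also have "\<dots> = (\<Prod>i\<in>I. emeasure (uniform_count_measure A) {s i})"
    using s I by (intro emeasure_PiM) (auto simp: sets_uniform_count_measure)
  also have "\<dots> = (\<Prod>i\<in>I. ennreal (1 / card A))"
    using s A by (intro prod.cong refl) (subst emeasure_uniform_count_measure, auto)
  also have "\<dots> = ennreal (1 / card (I \<rightarrow>\<^sub>E A))"
    using I by (simp add: card_PiE ennreal_power power_one_over)
  also have "\<dots> = emeasure (uniform_count_measure (I \<rightarrow>\<^sub>E A)) {s}"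
    using s fin by (subst emeasure_uniform_count_measure) auto
  finally show "emeasure (PiM I (\<lambda>_. uniform_count_measure A)) {s} =
    emeasure (uniform_count_measure (I \<rightarrow>\<^sub>E A)) {s}" .
qed

text \<open>The transposition fixes every index outside \<open>{1..B}\<close>, so the default value
  \<open>undefined\<close> stays in place.\<close>

lemma PiE_comp_transpose:
  fixes j B :: nat
  assumes "s \<in> {1..B} \<rightarrow>\<^sub>E A" "j \<in> {1..B}"
  shows "s \<circ> Transposition.transpose 1 j \<in> {1..B} \<rightarrow>\<^sub>E A"
proof (rule PiE_I)
  have p: "Transposition.transpose 1 j permutes {1..B}"
    using assms(2) by (intro permutes_swap_id) auto
  fix x :: nat
  show "(s \<circ> Transposition.transpose 1 j) x \<in> A" if "x \<in> {1..B}"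
    using PiE_mem[OF assms(1)] that permutes_in_image[OF p, of x] by (simp only: comp_apply)
  show "(s \<circ> Transposition.transpose 1 j) x = undefined" if "x \<notin> {1..B}"
    using PiE_arb[OF assms(1) that] permutes_not_in[OF p that] by (simp only: comp_apply)
qed

lemma distinct_perm_tuples_transpose:
  assumes "s \<in> distinct_perm_tuples n B" "j \<in> {1..B}"
  shows "s \<circ> Transposition.transpose 1 j \<in> distinct_perm_tuples n B"
proof -
  have "Transposition.transpose 1 j permutes {1..B}"
    using assms(2) by (intro permutes_swap_id) auto
  then have "inj_on (s \<circ> Transposition.transpose 1 j) {1..B}"
    using assms(1) by (intro comp_inj_on)
      (auto simp: distinct_perm_tuples_def permutes_image permutes_inj_on)
  then show ?thesis
    using assms PiE_comp_transpose[of s B "perms n" j] by (simp add: distinct_perm_tuples_def)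
qed

text \<open>Both sampling schemes enter the argument only through this common form. It is an
  integral formula and not an equation of measures because \<open>T\<close> may be smaller than the
  space of all tuples on which the law is defined.\<close>

lemma (in prob_space) sampled_perms_uniform:
  assumes perms: "sampled_with_replacement M n B \<pi> \<or> sampled_without_replacement M n B \<pi>"
    and B: "1 \<le> B"
    and meas: "(\<lambda>\<omega>. \<lambda>b\<in>{1..B}. \<pi> b \<omega>) \<in> M \<rightarrow>\<^sub>M PiM {1..B} (\<lambda>_. count_space (perms n))"
  obtains T where "finite T" and "T \<subseteq> {1..B} \<rightarrow>\<^sub>E perms n"
    and "\<And>s j. s \<in> T \<Longrightarrow> j \<in> {1..B} \<Longrightarrow> s \<circ> Transposition.transpose 1 j \<in> T"
    and "\<And>g :: _ \<Rightarrow> ennreal.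
      (\<integral>\<^sup>+s. g s \<partial>distr M (PiM {1..B} (\<lambda>_. count_space (perms n))) (\<lambda>\<omega>. \<lambda>b\<in>{1..B}. \<pi> b \<omega>)) =
      (\<Sum>s\<in>T. g s) * ennreal (1 / card T)"
  using perms
proof
  let ?P = "PiM {1..B} (\<lambda>_. count_space (perms n))"
  let ?\<pi> = "\<lambda>\<omega>. \<lambda>b\<in>{1..B}. \<pi> b \<omega>"
  assume w: "sampled_with_replacement M n B \<pi>"
  have rv: "\<pi> b \<in> M \<rightarrow>\<^sub>M count_space (perms n)" if "b \<in> {1..B}" for b
    using w that by (auto simp: sampled_with_replacement_def indep_vars_def)
  have "distr M ?P ?\<pi> = PiM {1..B} (\<lambda>b. distr M (count_space (perms n)) (\<pi> b))"
    using w B rv by (subst indep_vars_iff_distr_eq_PiM'[symmetric])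
      (auto simp: sampled_with_replacement_def)
  also have "\<dots> = PiM {1..B} (\<lambda>_. uniform_count_measure (perms n))"
    using w by (intro PiM_cong) (auto simp: sampled_with_replacement_def)
  also have "\<dots> = uniform_count_measure ({1..B} \<rightarrow>\<^sub>E perms n)"
    by (rule PiM_uniform_count_measure) (auto simp: finite_perms perms_nonempty)
  finally have law: "distr M ?P ?\<pi> = uniform_count_measure ({1..B} \<rightarrow>\<^sub>E perms n)" .
  have fin: "finite ({1..B} \<rightarrow>\<^sub>E perms n)" by (simp add: finite_PiE finite_perms)
  show thesis
    by (rule that[OF fin order_refl PiE_comp_transpose])
      (assumption, assumption, simp only: law nn_integral_uniform_count_measure[OF fin])
next
  let ?P = "PiM {1..B} (\<lambda>_. count_space (perms n))"
  let ?\<pi> = "\<lambda>\<omega>. \<lambda>b\<in>{1..B}. \<pi> b \<omega>"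
  let ?T = "distinct_perm_tuples n B"
  assume w: "sampled_without_replacement M n B \<pi>"
  have fin: "finite ?T"
    unfolding distinct_perm_tuples_def by (simp add: finite_PiE finite_perms)
  have int: "(\<integral>\<^sup>+s. g s \<partial>distr M ?P ?\<pi>) = (\<Sum>s\<in>?T. g s) * ennreal (1 / card ?T)" for g :: "_ \<Rightarrow> ennreal"
  proof -
    have "(\<integral>\<^sup>+s. g s \<partial>distr M ?P ?\<pi>) = (\<integral>\<^sup>+\<omega>. g (?\<pi> \<omega>) \<partial>M)"
      \<comment> \<open>Every \<open>g\<close> is measurable here because the finite product of
        discrete spaces is discrete.\<close>
      by (rule nn_integral_distr[OF meas]) (simp only: measurable_distr_eq1 PiM_perms, simp)
    also have "\<dots> = (\<integral>\<^sup>+s. g s \<partial>distr M (count_space ?T) ?\<pi>)"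
      using w unfolding sampled_without_replacement_def
      by (intro nn_integral_distr[symmetric]) (blast, simp only: measurable_distr_eq1, simp)
    also have "\<dots> = (\<integral>\<^sup>+s. g s \<partial>uniform_count_measure ?T)"
      using w by (simp add: sampled_without_replacement_def)
    finally show ?thesis by (simp add: nn_integral_uniform_count_measure fin)
  qed
  show thesis
    by (rule that[OF fin _ distinct_perm_tuples_transpose int]) (auto simp: distinct_perm_tuples_def)
qed

text \<open>Fubini for the product law: the tuple is averaged over \<open>T\<close>, which leaves an
  expectation over the data for each fixed tuple.\<close>

lemma (in prob_space) nn_integral_indep_uniform:
  assumes indep: "indep_rvs M N X P Z"
    and Z: "\<And>g :: _ \<Rightarrow> ennreal. (\<integral>\<^sup>+s. g s \<partial>distr M P Z) = (\<Sum>s\<in>T. g s) * ennreal (1 / card T)"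
    and T: "T \<subseteq> space P"
    and f: "f \<in> borel_measurable (N \<Otimes>\<^sub>M P)"
  shows "(\<integral>\<^sup>+\<omega>. f (X \<omega>, Z \<omega>) \<partial>M) = (\<Sum>s\<in>T. \<integral>\<^sup>+\<omega>. f (X \<omega>, s) \<partial>M) * ennreal (1 / card T)"
proof -
  have X: "X \<in> M \<rightarrow>\<^sub>M N" and Z_meas: "Z \<in> M \<rightarrow>\<^sub>M P"
    using indep by (auto simp: indep_rvs_def)
  interpret Z: prob_space "distr M P Z" by (rule prob_space_distr[OF Z_meas])
  have f_s: "(\<lambda>\<omega>. f (X \<omega>, s)) \<in> borel_measurable M" if "s \<in> T" for s
    using T that by (intro measurable_compose[OF _ f] measurable_Pair X) auto
  have "(\<integral>\<^sup>+\<omega>. f (X \<omega>, Z \<omega>) \<partial>M) = (\<integral>\<^sup>+p. f p \<partial>distr M (N \<Otimes>\<^sub>M P) (\<lambda>\<omega>. (X \<omega>, Z \<omega>)))"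
    using X Z_meas f by (subst nn_integral_distr) auto
  also have "\<dots> = (\<integral>\<^sup>+x. \<integral>\<^sup>+s. f (x, s) \<partial>distr M P Z \<partial>distr M N X)"
    unfolding indep_rvs_distr_pair[OF indep]
    by (rule Z.nn_integral_fst[symmetric]) (use f in \<open>simp cong: measurable_cong_sets sets_pair_measure_cong\<close>)
  also have "\<dots> = (\<integral>\<^sup>+\<omega>. \<integral>\<^sup>+s. f (X \<omega>, s) \<partial>distr M P Z \<partial>M)"
    by (rule nn_integral_distr[OF X], rule Z.borel_measurable_nn_integral_fst)
      (use f in \<open>simp cong: measurable_cong_sets sets_pair_measure_cong\<close>)
  also have "\<dots> = (\<integral>\<^sup>+\<omega>. (\<Sum>s\<in>T. f (X \<omega>, s)) * ennreal (1 / card T) \<partial>M)"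
    by (simp only: Z)
  also have "\<dots> = (\<Sum>s\<in>T. \<integral>\<^sup>+\<omega>. f (X \<omega>, s) \<partial>M) * ennreal (1 / card T)"
    using f_s by (simp only: nn_integral_multc borel_measurable_sum nn_integral_sum)
  finally show ?thesis .
qed

subsection \<open>The tests\<close>

lemma le_SUP_iff_finite:
  fixes f :: "'i \<Rightarrow> real"
  assumes "finite A" "A \<noteq> {}"
  shows "c \<le> (SUP a\<in>A. f a) \<longleftrightarrow> (\<exists>a\<in>A. c \<le> f a)"
  using assms by (simp add: cSup_eq_Max Max_ge_iff)

text \<open>The inequality covers \<open>k = 0\<close>, where the quotient is zero, so the tuple set
  need not be shown nonempty.\<close>

lemma of_nat_mult_ennreal_inverse_le: "of_nat k * ennreal (1 / real k) \<le> 1"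
proof -
  have "of_nat k * ennreal (1 / real k) = ennreal (real k * (1 / real k))"
    by (simp only: ennreal_mult of_nat_0_le_iff divide_nonneg_nonneg zero_le_one
        ennreal_of_nat_eq_real_of_nat)
  also have "\<dots> \<le> 1" by (cases "k = 0") simp_all
  finally show ?thesis .
qed

lemma sets_Bex_const_le:
  fixes f :: "'i \<Rightarrow> 'a \<Rightarrow> real"
  assumes "finite A" "\<And>a. a \<in> A \<Longrightarrow> f a \<in> borel_measurable M"
  shows "{x \<in> space M. \<exists>a\<in>A. c \<le> f a x} \<in> sets M"
proof -
  have "(\<Union>a\<in>A. {x \<in> space M. c \<le> f a x}) \<in> sets M"
    using assms by (intro sets.finite_UN borel_measurable_le) auto
  also have "(\<Union>a\<in>A. {x \<in> space M. c \<le> f a x}) = {x \<in> space M. \<exists>a\<in>A. c \<le> f a x}" by auto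
  finally show ?thesis .
qed

lemma measurable_pair_count_space:
  assumes C: "countable C" and f: "\<And>s. s \<in> C \<Longrightarrow> (\<lambda>y. f (y, s)) \<in> N \<rightarrow>\<^sub>M K"
  shows "f \<in> N \<Otimes>\<^sub>M count_space C \<rightarrow>\<^sub>M K"
proof -
  have "(\<lambda>p. f (fst p, snd p)) \<in> N \<Otimes>\<^sub>M count_space C \<rightarrow>\<^sub>M K"
    by (rule measurable_compose_countable'[where f="\<lambda>s p. f (fst p, s)" and g=snd and I=C])
      (auto intro: C measurable_compose[OF measurable_fst f])
  then show ?thesis by simp
qed

lemma perms_image_mem: "p \<in> perms n \<Longrightarrow> i \<in> {1..n} \<Longrightarrow> p i \<in> {1..n}"
  unfolding perms_def mem_Collect_eq by (simp only: permutes_in_image)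

lemma wealth_reordered_measurable:
  assumes strat: "betting_strategy n lam" and p: "p \<in> perms n"
  shows "(\<lambda>y. wealth lam n (\<lambda>i. y (p i))) \<in> borel_measurable (PiM {1..n} (\<lambda>_. borel))"
proof (rule wealth_measurable[OF strat order_refl])
  fix i assume "i \<in> {1..n}"
  with p have "p i \<in> {1..n}" by (rule perms_image_mem)
  then show "(\<lambda>y. y (p i)) \<in> borel_measurable (PiM {1..n} (\<lambda>_. borel))"
    by (rule measurable_component_singleton)
qed

text \<open>Independence, support and the common mean all survive a fixed reordering. The
  observations may have different laws, so the reordered data need not have the same joint law as
  the original.\<close>

lemma (in prob_space) nn_integral_wealth_reordered:
  assumes indep: "indep_vars (\<lambda>_. borel) Y {1..n}"
    and supp: "\<And>i. i \<in> {1..n} \<Longrightarrow> AE \<omega> in M. Y i \<omega> \<in> {0..1}"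
    and mean: "\<And>i. i \<in> {1..n} \<Longrightarrow> expectation (Y i) = 1/2"
    and strat: "betting_strategy n lam" and p: "p \<in> perms n"
  shows "(\<integral>\<^sup>+\<omega>. ennreal (wealth lam n (\<lambda>i. Y (p i) \<omega>)) \<partial>M) = 1"
proof (rule nn_integral_wealth_indep[OF _ _ _ strat])
  have p': "p permutes {1..n}" using p by (simp add: perms_def)
  show "indep_vars (\<lambda>_. borel) (\<lambda>i. Y (p i)) {1..n}"
    using indep_vars_reindex[of "\<lambda>_. borel" Y p "{1..n}"] indep
    unfolding permutes_image[OF p'] by (blast intro: permutes_inj_on[OF p'])
  fix i assume "i \<in> {1..n}"
  with p have "p i \<in> {1..n}" by (rule perms_image_mem)
  then show "AE \<omega> in M. Y (p i) \<omega> \<in> {0..1}" "expectation (Y (p i)) = 1/2"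
    by (rule supp mean)+
qed

text \<open>The form in which randomized Markov is applied to all four tests. The bound
  \<open>U \<omega> \<le> 1\<close> may be assumed in \<open>le\<close> since it holds almost
  surely; it makes a crossing of \<open>1 / \<alpha>\<close> imply the randomized crossing.\<close>

lemma (in prob_space) rejection_prob_leI:
  fixes H :: "'b \<Rightarrow> real"
  assumes indep: "indep_rvs M N X borel U"
    and U: "distr M borel U = uniform_measure lborel {0..1}"
    and H: "H \<in> borel_measurable N"
    and E: "(\<integral>\<^sup>+\<omega>. ennreal (H (X \<omega>)) \<partial>M) \<le> 1"
    and \<alpha>: "0 \<le> \<alpha>"
    and R: "{\<omega> \<in> space M. R \<omega>} \<in> sets M"
    and le: "\<And>\<omega>. \<omega> \<in> space M \<Longrightarrow> U \<omega> \<le> 1 \<Longrightarrow> R \<omega> \<Longrightarrow> U \<omega> \<le> \<alpha> * H (X \<omega>)"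
  shows "rejection_prob_le M \<alpha> R"
proof -
  have X: "X \<in> M \<rightarrow>\<^sub>M N" and U_meas: "U \<in> borel_measurable M"
    using indep by (auto simp: indep_rvs_def)
  have "AE u in distr M borel U. u \<le> 1"
    unfolding U by (rule AE_uniform_measureI) auto
  then have U1: "AE \<omega> in M. U \<omega> \<le> 1" by (rule AE_distrD[OF U_meas])
  have "prob {\<omega> \<in> space M. R \<omega>} \<le> prob {\<omega> \<in> space M. U \<omega> \<le> \<alpha> * H (X \<omega>)}"
  proof (rule finite_measure_mono_AE)
    show "AE \<omega> in M. \<omega> \<in> {\<omega> \<in> space M. R \<omega>} \<longrightarrow> \<omega> \<in> {\<omega> \<in> space M. U \<omega> \<le> \<alpha> * H (X \<omega>)}"
      using U1 by eventually_elim (use le in auto)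
    show "{\<omega> \<in> space M. U \<omega> \<le> \<alpha> * H (X \<omega>)} \<in> events"
      by (intro borel_measurable_le U_meas borel_measurable_times borel_measurable_const
          measurable_compose[OF X H])
  qed
  also have "\<dots> \<le> \<alpha>" by (rule uniform_randomized_markov[OF indep U H E \<alpha>])
  finally show ?thesis using R by (simp add: rejection_prob_le_def)
qed

theorem proposition8p1:
  fixes M :: "'a measure"
    and Y :: "nat \<Rightarrow> 'a \<Rightarrow> real"
    and U :: "'a \<Rightarrow> real"
    and \<pi> :: "nat \<Rightarrow> 'a \<Rightarrow> nat \<Rightarrow> nat"
    and lam :: "nat \<Rightarrow> (nat \<Rightarrow> real) \<Rightarrow> real"
    and n B :: nat
    and \<mu> \<alpha> :: real
  assumes M: "prob_space M"
    and Y_indep: "prob_space.indep_vars M (\<lambda>_. borel) Y {1..n}"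
    and Y_supp: "\<And>i. i \<in> {1..n} \<Longrightarrow> AE \<omega> in M. Y i \<omega> \<in> {0..1}"
    and Y_mean: "\<And>i. i \<in> {1..n} \<Longrightarrow> prob_space.expectation M (Y i) = \<mu>"
    and alpha: "0 < \<alpha>" "\<alpha> < 1"
    and strategy: "betting_strategy n lam"
    and B: "1 \<le> B"
    and perms: "sampled_with_replacement M n B \<pi> \<or> sampled_without_replacement M n B \<pi>"
    and perms_indep: "indep_rvs M
          (PiM {1..n} (\<lambda>_. borel)) (\<lambda>\<omega>. \<lambda>i\<in>{1..n}. Y i \<omega>)
          (PiM {1..B} (\<lambda>_. count_space (perms n))) (\<lambda>\<omega>. \<lambda>b\<in>{1..B}. \<pi> b \<omega>)"
    and U_unif: "distr M borel U = uniform_measure lborel {0..1}"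
    and U_indep: "indep_rvs M
          (PiM {1..n} (\<lambda>_. borel) \<Otimes>\<^sub>M PiM {1..B} (\<lambda>_. count_space (perms n)))
          (\<lambda>\<omega>. (\<lambda>i\<in>{1..n}. Y i \<omega>, \<lambda>b\<in>{1..B}. \<pi> b \<omega>))
          borel U"
  shows "let
      W = (\<lambda>t \<omega>. wealth lam t (\<lambda>i. Y i \<omega>));
      Wp = (\<lambda>b \<omega>. wealth lam n (\<lambda>i. Y (\<pi> b \<omega> i) \<omega>));
      avg = (\<lambda>b \<omega>. (\<Sum>j=1..b. Wp j \<omega>) / real b);
      ville = (\<lambda>\<omega>. (SUP t\<in>{0..n}. W t \<omega>) \<ge> 1 / \<alpha>);
      markov = (\<lambda>\<omega>. avg B \<omega> \<ge> 1 / \<alpha>);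
      test_a = (\<lambda>\<omega>. (SUP t\<in>{0..n}. W t \<omega>) \<ge> 1 / \<alpha> \<or> W n \<omega> \<ge> U \<omega> / \<alpha>);
      test_b = (\<lambda>\<omega>. avg B \<omega> \<ge> U \<omega> / \<alpha>);
      test_c = (\<lambda>\<omega>. (SUP b\<in>{1..B}. avg b \<omega>) \<ge> 1 / \<alpha>);
      test_d = (\<lambda>\<omega>. Wp 1 \<omega> \<ge> U \<omega> / \<alpha> \<or> (SUP b\<in>{1..B}. avg b \<omega>) \<ge> 1 / \<alpha>)
    in
      (\<mu> = 1/2 \<longrightarrow>
         rejection_prob_le M \<alpha> test_a \<and> rejection_prob_le M \<alpha> test_b \<and>
         rejection_prob_le M \<alpha> test_c \<and> rejection_prob_le M \<alpha> test_d) \<and>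
      (\<forall>\<omega>\<in>space M. ville \<omega> \<longrightarrow> test_a \<omega>) \<and>
      (\<forall>\<omega>\<in>space M. U \<omega> \<in> {0..1} \<longrightarrow> markov \<omega> \<longrightarrow> test_b \<omega>) \<and>
      (\<forall>\<omega>\<in>space M. markov \<omega> \<longrightarrow> test_c \<omega>) \<and>
      (\<forall>\<omega>\<in>space M. markov \<omega> \<longrightarrow> test_d \<omega>)"
proof -
  interpret prob_space M by (rule M)
  let ?W = "\<lambda>t \<omega>. wealth lam t (\<lambda>i. Y i \<omega>)"
  let ?Wp = "\<lambda>b \<omega>. wealth lam n (\<lambda>i. Y (\<pi> b \<omega> i) \<omega>)"
  let ?avg = "\<lambda>b \<omega>. (\<Sum>j=1..b. ?Wp j \<omega>) / real b"
  let ?a = "\<lambda>\<omega>. (SUP t\<in>{0..n}. ?W t \<omega>) \<ge> 1 / \<alpha> \<or> ?W n \<omega> \<ge> U \<omega> / \<alpha>"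
  let ?b = "\<lambda>\<omega>. ?avg B \<omega> \<ge> U \<omega> / \<alpha>"
  let ?c = "\<lambda>\<omega>. (SUP b\<in>{1..B}. ?avg b \<omega>) \<ge> 1 / \<alpha>"
  let ?d = "\<lambda>\<omega>. ?Wp 1 \<omega> \<ge> U \<omega> / \<alpha> \<or> ?c \<omega>"
  let ?N = "PiM {1..n} (\<lambda>_. borel) :: (nat \<Rightarrow> real) measure"
  let ?P = "PiM {1..B} (\<lambda>_. count_space (perms n))"
  let ?C = "{1..B} \<rightarrow>\<^sub>E perms n"
  let ?X = "\<lambda>\<omega>. \<lambda>i\<in>{1..n}. Y i \<omega>"
  let ?\<pi> = "\<lambda>\<omega>. \<lambda>b\<in>{1..B}. \<pi> b \<omega>"

  \<comment> \<open>Thresholds, measurability, and the statistics as functions of data and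
    permutations\<close>
  have sup_W: "c \<le> (SUP t\<in>{0..n}. ?W t \<omega>) \<longleftrightarrow> (\<exists>t\<in>{0..n}. c \<le> ?W t \<omega>)" for c \<omega>
    by (rule le_SUP_iff_finite) auto
  have sup_avg: "c \<le> (SUP b\<in>{1..B}. ?avg b \<omega>) \<longleftrightarrow> (\<exists>b\<in>{1..B}. c \<le> ?avg b \<omega>)" for c \<omega>
    using B by (intro le_SUP_iff_finite) auto
  have le_div: "u / \<alpha> \<le> w \<longleftrightarrow> u \<le> \<alpha> * w" for u w
    using alpha by (simp add: pos_divide_le_eq mult.commute)
  have hit_le: "u \<le> \<alpha> * w" if "1 / \<alpha> \<le> w" "u \<le> 1" for u w
    using that(1) that(2) unfolding le_div by linarith

  have C: "countable ?C" by (simp add: countable_finite finite_PiE finite_perms)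
  have Y_meas: "Y i \<in> borel_measurable M" if "i \<in> {1..n}" for i
    using Y_indep that by (auto simp: indep_vars_def)
  have XP: "(\<lambda>\<omega>. (?X \<omega>, ?\<pi> \<omega>)) \<in> M \<rightarrow>\<^sub>M ?N \<Otimes>\<^sub>M ?P" and U_meas: "U \<in> borel_measurable M"
    using U_indep by (auto simp: indep_rvs_def)
  have P_meas: "?\<pi> \<in> M \<rightarrow>\<^sub>M ?P" using perms_indep by (simp add: indep_rvs_def)
  have \<pi>_perms: "\<pi> b \<omega> \<in> perms n" if "b \<in> {1..B}" "\<omega> \<in> space M" for b \<omega>
    using measurable_space[OF P_meas that(2)] that(1) by (auto simp: space_PiM PiE_iff)

  \<comment> \<open>\<open>U\<close> is independent of the data and permutations jointly, so the
    statistics are written as functions of that pair.\<close>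
  define G where "G b = (\<lambda>(y, s :: nat \<Rightarrow> nat \<Rightarrow> nat). wealth lam n (\<lambda>i. y (s b i)))" for b :: nat
  define A where "A b p = (\<Sum>j=1..b. G j p) / real b" for b p
  \<comment> \<open>A permutation keeps indices inside \<open>{1..n}\<close>, where the restricted
    data vector agrees with \<open>Y\<close>.\<close>
  have G_eq: "G b (?X \<omega>, s) = wealth lam n (\<lambda>i. Y (s b i) \<omega>)" if "s b \<in> perms n" for b s \<omega>
    unfolding G_def case_prod_conv
  proof (rule wealth_cong)
    fix i assume "i \<in> {1..n}"
    with that have "s b i \<in> {1..n}" by (rule perms_image_mem)
    then show "?X \<omega> (s b i) = Y (s b i) \<omega>" by simp
  qed
  have G: "G b (?X \<omega>, ?\<pi> \<omega>) = ?Wp b \<omega>" if "b \<in> {1..B}" "\<omega> \<in> space M" for b \<omega>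
    using G_eq[of "?\<pi> \<omega>" b \<omega>] \<pi>_perms[OF that] that(1) by simp
  have A: "A b (?X \<omega>, ?\<pi> \<omega>) = ?avg b \<omega>" if "b \<in> {1..B}" "\<omega> \<in> space M" for b \<omega>
    unfolding A_def using that by (intro arg_cong2[of _ _ _ _ "(/)"] sum.cong refl G) auto
  have G_meas: "G b \<in> borel_measurable (?N \<Otimes>\<^sub>M ?P)" if "b \<in> {1..B}" for b
    unfolding PiM_perms
  proof (rule measurable_pair_count_space[OF C])
    fix s assume "s \<in> ?C"
    then show "(\<lambda>y. G b (y, s)) \<in> borel_measurable ?N"
      unfolding G_def case_prod_conv using that
      by (intro wealth_reordered_measurable[OF strategy]) auto
  qed
  have A_meas: "A b \<in> borel_measurable (?N \<Otimes>\<^sub>M ?P)" if "b \<in> {1..B}" for b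
    unfolding A_def using that
    by (intro borel_measurable_divide borel_measurable_sum borel_measurable_const G_meas) auto
  have Wp_meas: "?Wp b \<in> borel_measurable M" if "b \<in> {1..B}" for b
    using measurable_compose[OF XP G_meas[OF that]] G[OF that]
    by (simp cong: measurable_cong)
  have avg_meas: "?avg b \<in> borel_measurable M" if "b \<in> {1..B}" for b
    using that by (intro borel_measurable_divide borel_measurable_sum borel_measurable_const Wp_meas) auto
  have W_meas: "?W t \<in> borel_measurable M" if "t \<in> {0..n}" for t
    using that by (intro wealth_measurable[OF strategy] Y_meas) auto
  have U_le: "{\<omega> \<in> space M. U \<omega> / \<alpha> \<le> f \<omega>} \<in> sets M" if "f \<in> borel_measurable M" for f
    using that U_meas by (intro borel_measurable_le borel_measurable_divide borel_measurable_const)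
  have sup_sets: "{\<omega> \<in> space M. ?c \<omega>} \<in> sets M"
    unfolding sup_avg by (rule sets_Bex_const_le[OF _ avg_meas]) simp_all

  \<comment> \<open>Type-I error control when the mean is one half\<close>
  have type_I: "rejection_prob_le M \<alpha> ?a \<and> rejection_prob_le M \<alpha> ?b \<and>
      rejection_prob_le M \<alpha> ?c \<and> rejection_prob_le M \<alpha> ?d" if "\<mu> = 1/2"
  proof -
    have Y_half: "expectation (Y i) = 1/2" if "i \<in> {1..n}" for i
      using Y_mean[OF that] \<open>\<mu> = 1/2\<close> by simp
    note reject = rejection_prob_leI[OF U_indep U_unif _ _ less_imp_le[OF alpha(1)]]
    \<comment> \<open>The strategy is left arbitrary so that the stopped strategy of test (a) is
      covered too.\<close>
    have unit_mean: "(\<integral>\<^sup>+\<omega>. ennreal (wealth l n (\<lambda>i. Y (p i) \<omega>)) \<partial>M) = 1"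
      if "betting_strategy n l" "p \<in> perms n" for l p
      by (rule nn_integral_wealth_reordered[OF Y_indep _ _ that]) (rule Y_supp Y_half, assumption)+

    obtain T where T: "finite T" "T \<subseteq> ?C"
        "\<And>s j. s \<in> T \<Longrightarrow> j \<in> {1..B} \<Longrightarrow> s \<circ> Transposition.transpose 1 j \<in> T"
        and law: "\<And>g :: _ \<Rightarrow> ennreal.
          (\<integral>\<^sup>+s. g s \<partial>distr M ?P ?\<pi>) = (\<Sum>s\<in>T. g s) * ennreal (1 / card T)"
      by (rule sampled_perms_uniform[OF perms B P_meas]) blast
    have TP: "T \<subseteq> space ?P" using T(2) by (simp add: space_PiM)
    have T_perms: "s b \<in> perms n" if "s \<in> T" "b \<in> {1..B}" for s b
      by (rule PiE_mem[OF subsetD[OF T(2) that(1)] that(2)])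
    have G_mean: "(\<integral>\<^sup>+\<omega>. ennreal (G b (?X \<omega>, s)) \<partial>M) = 1" if "s \<in> T" "b \<in> {1..B}" for s b
      by (simp only: G_eq[of s b, OF T_perms[OF that]] unit_mean[OF strategy T_perms[OF that]])
    have X_meas: "?X \<in> M \<rightarrow>\<^sub>M ?N" using perms_indep by (simp add: indep_rvs_def)
    have section_sum: "(\<integral>\<^sup>+\<omega>. (\<Sum>s\<in>T. ennreal (H (?X \<omega>, s))) \<partial>M) =
        (\<Sum>s\<in>T. \<integral>\<^sup>+\<omega>. ennreal (H (?X \<omega>, s)) \<partial>M)"
      if H: "H \<in> borel_measurable (?N \<Otimes>\<^sub>M ?P)" for H
    proof (rule nn_integral_sum)
      fix s assume "s \<in> T"
      then have "s \<in> space ?P" using TP by blast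
      then show "(\<lambda>\<omega>. ennreal (H (?X \<omega>, s))) \<in> borel_measurable M"
        by (intro measurable_compose[OF _ measurable_ennreal] measurable_compose[OF _ H]
            measurable_Pair X_meas measurable_const)
    qed
    have joint: "(\<integral>\<^sup>+\<omega>. ennreal (H (?X \<omega>, ?\<pi> \<omega>)) \<partial>M) =
        (\<Sum>s\<in>T. \<integral>\<^sup>+\<omega>. ennreal (H (?X \<omega>, s)) \<partial>M) * ennreal (1 / card T)"
      if "H \<in> borel_measurable (?N \<Otimes>\<^sub>M ?P)" for H
      using that by (intro nn_integral_indep_uniform[OF perms_indep law TP, where f="\<lambda>p. ennreal (H p)"]) simp
    note card_le = of_nat_mult_ennreal_inverse_le[of "card T"]
    have Wp_mean: "(\<integral>\<^sup>+\<omega>. ennreal (G b (?X \<omega>, ?\<pi> \<omega>)) \<partial>M) \<le> 1" if "b \<in> {1..B}" for b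
      using card_le by (simp only: joint[OF G_meas[OF that]] G_mean[OF _ that] sum_constant mult_1_right cong: sum.cong)

    \<comment> \<open>The permutation component is ignored; it is carried along to match the pair in
      \<open>U_indep\<close>.\<close>
    define stop where "stop = (\<lambda>(y, s :: nat \<Rightarrow> nat \<Rightarrow> nat). wealth (stop_betting (1 / \<alpha>) lam) n y)"
    have strategy': "betting_strategy n (stop_betting (1 / \<alpha>) lam)"
      by (rule betting_strategy_stop_betting[OF strategy])
    have stop_eq: "stop (?X \<omega>, s) = wealth (stop_betting (1 / \<alpha>) lam) n (\<lambda>i. Y i \<omega>)" for \<omega> s
      unfolding stop_def case_prod_conv by (rule wealth_cong) simp
    have a: "rejection_prob_le M \<alpha> ?a"
    proof (rule reject[of stop])
      show "stop \<in> borel_measurable (?N \<Otimes>\<^sub>M ?P)"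
        unfolding stop_def case_prod_beta
        by (rule wealth_measurable[OF strategy' order_refl])
          (rule measurable_compose[OF measurable_fst measurable_component_singleton])
      show "(\<integral>\<^sup>+\<omega>. ennreal (stop (?X \<omega>, ?\<pi> \<omega>)) \<partial>M) \<le> 1"
        \<comment> \<open>The original ordering is the reordering by the identity
          permutation.\<close>
        unfolding stop_eq using unit_mean[OF strategy', of id]
        by (simp add: perms_def permutes_id)
      show "{\<omega> \<in> space M. ?a \<omega>} \<in> sets M"
        unfolding sup_W
        by (intro sets.sets_Collect_disj sets_Bex_const_le U_le W_meas finite_atLeastAtMost) simp_all
      fix \<omega> assume "U \<omega> \<le> 1" "?a \<omega>"
      show "U \<omega> \<le> \<alpha> * stop (?X \<omega>, ?\<pi> \<omega>)"
      proof (cases "\<exists>t\<le>n. 1 / \<alpha> \<le> ?W t \<omega>")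
        case True
        then have "1 / \<alpha> \<le> stop (?X \<omega>, ?\<pi> \<omega>)"
          using wealth_stop_betting[of n "1 / \<alpha>" lam "\<lambda>i. Y i \<omega>"] by (simp only: if_True stop_eq)
        then show ?thesis using \<open>U \<omega> \<le> 1\<close> by (rule hit_le)
      next
        case False
        then have "stop (?X \<omega>, ?\<pi> \<omega>) = ?W n \<omega>"
          using wealth_stop_betting[of n "1 / \<alpha>" lam "\<lambda>i. Y i \<omega>"] by (simp only: if_False stop_eq)
        moreover have "U \<omega> / \<alpha> \<le> ?W n \<omega>"
          using \<open>?a \<omega>\<close> False unfolding sup_W by auto
        ultimately show ?thesis by (simp only: le_div)
      qed
    qed

    have b: "rejection_prob_le M \<alpha> ?b"
    proof (rule reject[of "A B"])
      show "A B \<in> borel_measurable (?N \<Otimes>\<^sub>M ?P)" using B by (intro A_meas) auto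
      have "(\<integral>\<^sup>+\<omega>. ennreal (A B (?X \<omega>, ?\<pi> \<omega>)) \<partial>M) \<le>
          (\<integral>\<^sup>+\<omega>. (\<Sum>j=1..B. ennreal (G j (?X \<omega>, ?\<pi> \<omega>))) * ennreal (1 / B) \<partial>M)"
      proof (rule nn_integral_mono)
        fix \<omega>
        \<comment> \<open>The nonnegative factor \<open>1 / B\<close> comes out exactly; only
          splitting the sum costs an inequality.\<close>
        have "ennreal (A B p) = ennreal (\<Sum>j=1..B. G j p) * ennreal (1 / B)" for p
          using ennreal_mult''[of "1 / real B" "\<Sum>j=1..B. G j p"] by (simp add: A_def)
        then show "ennreal (A B (?X \<omega>, ?\<pi> \<omega>)) \<le>
            (\<Sum>j=1..B. ennreal (G j (?X \<omega>, ?\<pi> \<omega>))) * ennreal (1 / B)"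
          by (simp only: mult_right_mono ennreal_sum_le zero_le)
      qed
      also have "\<dots> = (\<Sum>j=1..B. \<integral>\<^sup>+\<omega>. ennreal (G j (?X \<omega>, ?\<pi> \<omega>)) \<partial>M) * ennreal (1 / B)"
        by (simp only: nn_integral_multc nn_integral_sum borel_measurable_sum
            measurable_compose[OF measurable_compose[OF XP G_meas] measurable_ennreal])
      also have "\<dots> \<le> (\<Sum>j=1..B. 1) * ennreal (1 / B)"
        by (intro mult_right_mono sum_mono Wp_mean) auto
      also have "\<dots> \<le> 1"
        using of_nat_mult_ennreal_inverse_le[of B] by simp
      finally show "(\<integral>\<^sup>+\<omega>. ennreal (A B (?X \<omega>, ?\<pi> \<omega>)) \<partial>M) \<le> 1" .
      show "{\<omega> \<in> space M. ?b \<omega>} \<in> sets M" using B by (intro U_le avg_meas) auto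
      fix \<omega> assume "\<omega> \<in> space M" "?b \<omega>"
      then show "U \<omega> \<le> \<alpha> * A B (?X \<omega>, ?\<pi> \<omega>)" using B by (simp only: A le_div) (subst A, auto)
    qed

    \<comment> \<open>Both (c) and (d) reject only if \<open>U / \<alpha> \<le> D\<close>, up to a null event.\<close>
    define D where "D p = (if \<exists>b\<in>{1..B}. 1 / \<alpha> \<le> A b p then 1 / \<alpha> else G 1 p)" for p
    have one: "1 \<in> {1..B}" using B by simp
    have D_meas: "D \<in> borel_measurable (?N \<Otimes>\<^sub>M ?P)"
      unfolding D_def
      by (intro measurable_If borel_measurable_const G_meas[OF one] sets_Bex_const_le A_meas) auto
    \<comment> \<open>The sum over \<open>T\<close> moves inside the expectation so that the maximal
      inequality applies with the data frozen, \<open>g\<close> being the wealth along a single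
      permutation.\<close>
    have "(\<Sum>s\<in>T. \<integral>\<^sup>+\<omega>. ennreal (D (?X \<omega>, s)) \<partial>M) =
        (\<integral>\<^sup>+\<omega>. (\<Sum>s\<in>T. ennreal (D (?X \<omega>, s))) \<partial>M)"
      by (rule section_sum[OF D_meas, symmetric])
    also have "\<dots> \<le> (\<integral>\<^sup>+\<omega>. (\<Sum>s\<in>T. ennreal (G 1 (?X \<omega>, s))) \<partial>M)"
    proof (rule nn_integral_mono)
      fix \<omega>
      show "(\<Sum>s\<in>T. ennreal (D (?X \<omega>, s))) \<le> (\<Sum>s\<in>T. ennreal (G 1 (?X \<omega>, s)))"
        using exchangeable_stopped_sum_le[OF T(1) T(3), of B "1 / \<alpha>" "\<lambda>p. wealth lam n (\<lambda>i. ?X \<omega> (p i))"] alpha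
        unfolding D_def A_def G_def case_prod_conv by simp
    qed
    also have "\<dots> = (\<Sum>s\<in>T. \<integral>\<^sup>+\<omega>. ennreal (G 1 (?X \<omega>, s)) \<partial>M)"
      by (rule section_sum[OF G_meas[OF one]])
    also have "\<dots> = of_nat (card T)" by (simp only: G_mean[OF _ one] sum_constant mult_1_right cong: sum.cong)
    finally have D_sum: "(\<Sum>s\<in>T. \<integral>\<^sup>+\<omega>. ennreal (D (?X \<omega>, s)) \<partial>M) \<le> of_nat (card T)" .
    have D_mean: "(\<integral>\<^sup>+\<omega>. ennreal (D (?X \<omega>, ?\<pi> \<omega>)) \<partial>M) \<le> 1"
      unfolding joint[OF D_meas] by (rule order_trans[OF mult_right_mono[OF D_sum] card_le]) simp
    have D_le: "U \<omega> \<le> \<alpha> * D (?X \<omega>, ?\<pi> \<omega>)" if "\<omega> \<in> space M" "U \<omega> \<le> 1" "?d \<omega>" for \<omega>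
    proof (cases "\<exists>b\<in>{1..B}. 1 / \<alpha> \<le> ?avg b \<omega>")
      case True
      then have "1 / \<alpha> \<le> D (?X \<omega>, ?\<pi> \<omega>)"
        using A[OF _ that(1)] unfolding D_def by auto
      then show ?thesis using that(2) by (rule hit_le)
    next
      case False
      then have "D (?X \<omega>, ?\<pi> \<omega>) = ?Wp 1 \<omega>"
        using A[OF _ that(1)] G[OF one that(1)] unfolding D_def by auto
      moreover have "U \<omega> / \<alpha> \<le> ?Wp 1 \<omega>" using that(3) False unfolding sup_avg by blast
      ultimately show ?thesis by (simp only: le_div)
    qed
    \<comment> \<open>Test (c) is a disjunct of test (d), so \<open>D_le\<close> covers
      both.\<close>
    have c: "rejection_prob_le M \<alpha> ?c"
      by (rule reject[OF D_meas D_mean sup_sets]) (use D_le in blast)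
    have "{\<omega> \<in> space M. ?d \<omega>} \<in> sets M"
      by (intro sets.sets_Collect_disj U_le Wp_meas[OF one] sup_sets)
    then have "rejection_prob_le M \<alpha> ?d"
      by (rule reject[OF D_meas D_mean]) (rule D_le)
    with a b c show ?thesis by blast
  qed

  \<comment> \<open>Comparison with the rules that do not use the randomization or the running
    supremum\<close>
  have markov_b: "?b \<omega>" if "U \<omega> \<in> {0..1}" "1 / \<alpha> \<le> ?avg B \<omega>" for \<omega>
    using hit_le[OF that(2), of "U \<omega>"] that(1) unfolding le_div by simp
  have markov_c: "?c \<omega>" if "1 / \<alpha> \<le> ?avg B \<omega>" for \<omega>
    unfolding sup_avg using B that by (intro bexI[of _ B]) auto
  show ?thesis
    unfolding Let_def using type_I markov_b markov_c by blast
qed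

end
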